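(* Let $\Lambda$ and $\Theta$ be connected graphs, each with countably infinitely many vertices and each of infinite diameter. Then the Cartesian product $\Lambda\,\square\,\Theta$ has distinguishing number $2$.
   Context: Graphs are simple. The Cartesian product $\Lambda\,\square\,\Theta$ has vertex set $V\Lambda\times V\Theta$, with $(\lambda,\theta)$ adjacent to $(\lambda',\theta')$ if and only if either $\lambda=\lambda'$ and $\theta,\theta'$ are adjacent in $\Theta$, or $\theta=\theta'$ and $\lambda,\lambda'$ are adjacent in $\Lambda$. The diameter of a graph is the supremum of distances between its vertices. The distinguishing number of a graph is the least number of colors needed to color its vertices so that no non-identity automorphism preserves every color class setwise.
   Formalization: The distinguishing number is shown to be at most 2, and equal to 2 whenever the product has a non-identity automorphism; if the product has only the identity automorphism (e.g. a ray times a tree with legs 1, 2, ∞) the number is 1, so the claim as stated fails there. *)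

theory Defs
  imports
    "Graph_Theory.Shortest_Path"
    "Graph_Theory.Digraph_Isomorphism"
    "HOL-Library.Countable_Set"
    "HOL-Library.Extended_Nat"
begin

text \<open>
  Unlike the locale \<open>pair_graph\<close>, the locale \<open>pair_bidirected_digraph\<close> does not require
  finiteness; its models are exactly the simple graphs, an undirected edge being represented
  by its two orientations.
\<close>

abbreviation simple_graph :: "'a pair_pre_digraph \<Rightarrow> bool" where
  "simple_graph G \<equiv> pair_bidirected_digraph G"

definition cartesian_product ::
    "'a pair_pre_digraph \<Rightarrow> 'b pair_pre_digraph \<Rightarrow> ('a \<times> 'b) pair_pre_digraph"
    (infixr \<open>\<box>\<close> 70) where
  "G \<box> H =
    \<lparr> pverts = pverts G \<times> pverts H,
      parcs = {((u, x), (v, y)).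
        (u = v \<and> u \<in> pverts G \<and> (x, y) \<in> parcs H) \<or>
        (x = y \<and> x \<in> pverts H \<and> (u, v) \<in> parcs G)} \<rparr>"

text \<open>With all arc weights 1 the library's shortest path cost is the usual graph distance.\<close>

definition graph_distance :: "'a pair_pre_digraph \<Rightarrow> 'a \<Rightarrow> 'a \<Rightarrow> ereal" where
  "graph_distance G u v = wf_digraph.\<mu> (with_proj G) (\<lambda>_. 1) u v"

definition graph_diameter :: "'a pair_pre_digraph \<Rightarrow> ereal" where
  "graph_diameter G = (SUP u\<in>pverts G. SUP v\<in>pverts G. graph_distance G u v)"

definition graph_automorphism :: "'a pair_pre_digraph \<Rightarrow> ('a \<Rightarrow> 'a) \<Rightarrow> bool" where
  "graph_automorphism G f \<longleftrightarrow>
    bij_betw f (pverts G) (pverts G) \<and>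
    (\<forall>u\<in>pverts G. \<forall>v\<in>pverts G. (u, v) \<in> parcs G \<longleftrightarrow> (f u, f v) \<in> parcs G)"

text \<open>Functions are total, so being the identity only concerns the values on the vertex set.\<close>

definition distinguishing_colouring :: "'a pair_pre_digraph \<Rightarrow> ('a \<Rightarrow> 'c) \<Rightarrow> bool" where
  "distinguishing_colouring G c \<longleftrightarrow>
    (\<forall>f. graph_automorphism G f \<longrightarrow>
      (\<forall>i. f ` {v \<in> pverts G. c v = i} = {v \<in> pverts G. c v = i}) \<longrightarrow>
      (\<forall>v\<in>pverts G. f v = v))"

text \<open>
  The infimum of the empty set is \<open>\<infinity>\<close>, so \<open>\<infinity>\<close> means that no finite number of colours suffices.
  A nonempty graph whose only automorphism is the identity has distinguishing number 1.
\<close>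

definition distinguishing_number :: "'a pair_pre_digraph \<Rightarrow> enat" where
  "distinguishing_number G =
    Inf {enat k | k. \<exists>c :: 'a \<Rightarrow> nat. (\<forall>v\<in>pverts G. c v < k) \<and> distinguishing_colouring G c}"

lemma simple_graph_cartesian_product:
  assumes "simple_graph G" "simple_graph H"
  shows "simple_graph (G \<box> H)"
proof -
  interpret G: pair_bidirected_digraph G by fact
  interpret H: pair_bidirected_digraph H by fact
  have G: "(v, u) \<in> parcs G" if "(u, v) \<in> parcs G" for u v
    using G.pair_sym_arcs that by (auto simp: symmetric_def dest: symD)
  have H: "(v, u) \<in> parcs H" if "(u, v) \<in> parcs H" for u v
    using H.pair_sym_arcs that by (auto simp: symmetric_def dest: symD)
  show ?thesis
    by unfold_locales
      (auto simp: cartesian_product_def symmetric_def sym_def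
        dest: G H G.in_arcsD1 G.in_arcsD2 H.in_arcsD1 H.in_arcsD2 G.no_loops' H.no_loops')
qed

lemma graph_automorphism_iff_digraph_isomorphism:
  assumes "simple_graph G"
  shows "graph_automorphism G f \<longleftrightarrow>
    (\<exists>h. pre_digraph.digraph_isomorphism (with_proj G) h \<and>
      app_iso h (with_proj G) = with_proj G \<and> iso_verts h = f)"
    (is "?L \<longleftrightarrow> ?R")
proof -
  interpret G: pair_bidirected_digraph G by fact
  have wf: "wf_digraph (with_proj G)" by unfold_locales
  show ?thesis
  proof
    assume L: ?L
    let ?h = "\<lparr>iso_verts = f, iso_arcs = map_prod f f, iso_head = snd, iso_tail = fst\<rparr>"
    have inj: "inj_on f (pverts G)" and im: "f ` pverts G = pverts G"
      using L by (auto simp: graph_automorphism_def bij_betw_def)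
    have sub: "parcs G \<subseteq> pverts G \<times> pverts G"
      by (auto dest: G.in_arcsD1 G.in_arcsD2)
    have "inj_on (map_prod f f) (parcs G)"
      by (rule inj_on_subset[OF _ sub]) (use inj in \<open>auto simp: inj_on_def\<close>)
    moreover have "map_prod f f ` parcs G = parcs G"
    proof (intro equalityI subsetI)
      fix e assume "e \<in> map_prod f f ` parcs G"
      then show "e \<in> parcs G"
        using L sub by (auto simp: graph_automorphism_def)
    next
      fix e assume e: "e \<in> parcs G"
      obtain x y where xy: "e = (x, y)" by (cases e)
      with e sub have "x \<in> f ` pverts G" "y \<in> f ` pverts G" using im by auto
      then obtain u v where uv: "u \<in> pverts G" "v \<in> pverts G" "x = f u" "y = f v" by auto
      with L e xy have "(u, v) \<in> parcs G" by (auto simp: graph_automorphism_def)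
      then show "e \<in> map_prod f f ` parcs G" using uv xy by force
    qed
    ultimately have "pre_digraph.digraph_isomorphism (with_proj G) ?h \<and>
        app_iso ?h (with_proj G) = with_proj G \<and> iso_verts ?h = f"
      using wf inj im by (simp add: pre_digraph.digraph_isomorphism_def app_iso_def with_proj_def)
    then show ?R by blast
  next
    assume ?R
    then obtain h where h: "pre_digraph.digraph_isomorphism (with_proj G) h"
      and a: "app_iso h (with_proj G) = with_proj G" and f: "iso_verts h = f" by blast
    have im: "f ` pverts G = pverts G" and ia: "iso_arcs h ` parcs G = parcs G"
      and t: "iso_tail h = fst" and hd: "iso_head h = snd"
      using a f by (auto simp: app_iso_def with_proj_def)
    have inj: "inj_on f (pverts G)"
      using h f by (simp add: pre_digraph.digraph_isomorphism_def)
    have arc: "iso_arcs h (u, v) = (f u, f v)" if "(u, v) \<in> parcs G" for u v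
      using h f t hd that by (fastforce simp: pre_digraph.digraph_isomorphism_def prod_eq_iff)
    have "(u, v) \<in> parcs G \<longleftrightarrow> (f u, f v) \<in> parcs G"
      if uv: "u \<in> pverts G" "v \<in> pverts G" for u v
    proof
      assume "(u, v) \<in> parcs G"
      then show "(f u, f v) \<in> parcs G" using arc ia by (metis imageI)
    next
      assume "(f u, f v) \<in> parcs G"
      then obtain x y where xy: "(x, y) \<in> parcs G" "iso_arcs h (x, y) = (f u, f v)"
        using ia by (metis imageE surj_pair)
      then have "f x = f u" "f y = f v" using arc by auto
      then have "x = u" "y = v"
        using inj uv xy by (auto dest: inj_onD G.in_arcsD1 G.in_arcsD2)
      then show "(u, v) \<in> parcs G" using xy by simp
    qed
    then show ?L using inj im by (auto simp: graph_automorphism_def bij_betw_def)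
  qed
qed

end

theory Submission
  imports Defs
begin

text \<open>
  A vertex \<open>v\<close> and its neighbours are coloured black, and so is one vertex \<open>u k\<close> on each of
  infinitely many distant spheres around \<open>v\<close> whose radii differ by at least 2. Then \<open>v\<close> is the
  only black vertex all of whose neighbours are black, so a colour preserving automorphism fixes
  it, and hence every \<open>u k\<close>. If \<open>u k\<close> has different distances from the two members of the
  \<open>k\<close>-th pair of distinct vertices, then no vertex can move. In a product such separating vertices
  exist arbitrarily far away: for \<open>a \<noteq> b\<close> and any \<open>r\<close>, one of \<open>(a, r)\<close>, \<open>(b, r)\<close> has different
  distances from \<open>(a, p)\<close> and \<open>(b, q)\<close>.
\<close>

section \<open>Distance as least walk length\<close>

text \<open>Distances live on the bare arc relation with values in \<open>nat\<close>, so that they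
  can be added and cancelled freely. Without any walk from \<open>x\<close> to \<open>y\<close> the
  \<open>LEAST\<close> is an unspecified number, whence the reachability assumptions below.\<close>

definition walk_dist :: "('a \<times> 'a) set \<Rightarrow> 'a \<Rightarrow> 'a \<Rightarrow> nat" where
  "walk_dist E x y = (LEAST n. (x, y) \<in> E ^^ n)"

lemma walk_dist_le: "(x, y) \<in> E ^^ n \<Longrightarrow> walk_dist E x y \<le> n"
  unfolding walk_dist_def by (rule Least_le)

lemma relpow_walk_dist: "(x, y) \<in> E\<^sup>* \<Longrightarrow> (x, y) \<in> E ^^ walk_dist E x y"
  unfolding walk_dist_def by (meson LeastI_ex rtrancl_imp_relpow)

lemma walk_dist_self [simp]: "walk_dist E x x = 0"
  using walk_dist_le[of x x 0 E] by simp

lemma walk_dist_eq_0_iff: "(x, y) \<in> E\<^sup>* \<Longrightarrow> walk_dist E x y = 0 \<longleftrightarrow> x = y"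
  by (metis relpow_walk_dist relpow_0_E walk_dist_self)

lemma walk_dist_edge_le: "(x, y) \<in> E\<^sup>* \<Longrightarrow> (y, z) \<in> E \<Longrightarrow> walk_dist E x z \<le> Suc (walk_dist E x y)"
  by (rule walk_dist_le) (auto intro: relpow_walk_dist)

lemma walk_dist_sym: "sym E \<Longrightarrow> walk_dist E x y = walk_dist E y x"
proof -
  assume "sym E"
  then have "(x, y) \<in> E ^^ n \<longleftrightarrow> (y, x) \<in> E ^^ n" for n
  proof (induction n arbitrary: x y)
    case (Suc n)
    show ?case
      by (metis Suc.IH Suc.prems relpow_Suc_E relpow_Suc_E2 relpow_Suc_I relpow_Suc_I2 symD)
  qed auto
  then show ?thesis unfolding walk_dist_def by simp
qed

section \<open>Walks and distances in a Cartesian product\<close>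

context
  fixes A :: "'a set" and B :: "'b set" and R S P
  assumes R: "R \<subseteq> A \<times> A" and S: "S \<subseteq> B \<times> B"
    and P: "P = {((u, x), (v, y)). (u = v \<and> u \<in> A \<and> (x, y) \<in> S) \<or> (x = y \<and> x \<in> B \<and> (u, v) \<in> R)}"
begin

text \<open>Each arc of the product moves exactly one coordinate, so a walk sorts into its moves in
  \<open>R\<close> and its moves in \<open>S\<close>. Conversely, two such walks are performed one
  after the other.\<close>

lemma relpow_product_iff:
  assumes "a \<in> A" "p \<in> B"
  shows "((a, p), (b, q)) \<in> P ^^ n \<longleftrightarrow> (\<exists>i j. n = i + j \<and> (a, b) \<in> R ^^ i \<and> (p, q) \<in> S ^^ j)"
proof
  show "\<exists>i j. n = i + j \<and> (a, b) \<in> R ^^ i \<and> (p, q) \<in> S ^^ j" if "((a, p), (b, q)) \<in> P ^^ n"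
    using that
  proof (induction n arbitrary: b q)
    case (Suc n)
    then obtain b' q' where 1: "((a, p), (b', q')) \<in> P ^^ n" and 2: "((b', q'), (b, q)) \<in> P"
      by (metis relpow_Suc_E surj_pair)
    obtain i j where ij: "n = i + j" "(a, b') \<in> R ^^ i" "(p, q') \<in> S ^^ j"
      using Suc.IH[OF 1] by blast
    from 2 consider "b' = b" "(q', q) \<in> S" | "q' = q" "(b', b) \<in> R" unfolding P by auto
    then show ?case
    proof cases
      case 1
      then have "Suc n = i + Suc j \<and> (a, b) \<in> R ^^ i \<and> (p, q) \<in> S ^^ Suc j" using ij by auto
      then show ?thesis by blast
    next
      case 2
      then have "Suc n = Suc i + j \<and> (a, b) \<in> R ^^ Suc i \<and> (p, q) \<in> S ^^ j" using ij by auto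
      then show ?thesis by blast
    qed
  qed auto
next
  assume "\<exists>i j. n = i + j \<and> (a, b) \<in> R ^^ i \<and> (p, q) \<in> S ^^ j"
  then obtain i j where ij: "n = i + j" "(a, b) \<in> R ^^ i" "(p, q) \<in> S ^^ j" by blast
  \<comment> \<open>The conjunct \<open>b \<in> A\<close> travels with the induction because the
    moves along \<open>S\<close> that follow need their fixed first coordinate in
    \<open>A\<close>.\<close>
  have 1: "((a, p), (b, p)) \<in> P ^^ i \<and> b \<in> A"
    using ij(2)
  proof (induction i arbitrary: b)
    case (Suc i)
    then obtain c where "((a, p), (c, p)) \<in> P ^^ i" "(c, b) \<in> R" by auto
    moreover from this have "((c, p), (b, p)) \<in> P" using assms by (auto simp: P)
    ultimately show ?case using R by auto
  qed (use assms in auto)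
  have "((b, p), (b, q)) \<in> P ^^ j"
    using ij(3)
  proof (induction j arbitrary: q)
    case (Suc j)
    then obtain c where "((b, p), (b, c)) \<in> P ^^ j" "(c, q) \<in> S" by auto
    moreover from this have "((b, c), (b, q)) \<in> P" using 1 by (auto simp: P)
    ultimately show ?case by auto
  qed auto
  with 1 ij(1) show "((a, p), (b, q)) \<in> P ^^ n"
    by (auto simp: relpow_add)
qed

lemma rtrancl_product:
  assumes "a \<in> A" "p \<in> B" "(a, b) \<in> R\<^sup>*" "(p, q) \<in> S\<^sup>*"
  shows "((a, p), (b, q)) \<in> P\<^sup>*"
proof -
  obtain i j where "(a, b) \<in> R ^^ i" "(p, q) \<in> S ^^ j"
    using assms(3,4) rtrancl_imp_relpow by metis
  then have "((a, p), (b, q)) \<in> P ^^ (i + j)"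
    using assms(1,2) by (auto simp: relpow_product_iff)
  then show ?thesis by (rule relpow_imp_rtrancl)
qed

text \<open>Shortest walks in the factors combine to a product walk of the summed length, and a
  shortest product walk splits into factor walks that are no shorter than the factor
  distances.\<close>

lemma walk_dist_product:
  assumes "a \<in> A" "p \<in> B" "(a, b) \<in> R\<^sup>*" "(p, q) \<in> S\<^sup>*"
  shows "walk_dist P (a, p) (b, q) = walk_dist R a b + walk_dist S p q"
proof (rule antisym)
  show "walk_dist P (a, p) (b, q) \<le> walk_dist R a b + walk_dist S p q"
    using assms by (intro walk_dist_le) (auto simp: relpow_product_iff intro!: relpow_walk_dist exI)
  obtain i j where "walk_dist P (a, p) (b, q) = i + j" "(a, b) \<in> R ^^ i" "(p, q) \<in> S ^^ j"
    using relpow_walk_dist[OF rtrancl_product[OF assms]] assms by (auto simp: relpow_product_iff)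
  then show "walk_dist R a b + walk_dist S p q \<le> walk_dist P (a, p) (b, q)"
    by (simp add: add_mono walk_dist_le)
qed

end

section \<open>Automorphisms preserve distance\<close>

text \<open>Walks map forward arc by arc, and surjectivity on the vertex set lifts every walk from
  \<open>f x\<close> back. Both inductions keep track of membership in \<open>pverts G\<close>,
  since \<open>f\<close> is controlled only there.\<close>

lemma walk_dist_automorphism:
  assumes f: "graph_automorphism G f" and E: "parcs G \<subseteq> pverts G \<times> pverts G"
    and x: "x \<in> pverts G" and y: "y \<in> pverts G"
  shows "walk_dist (parcs G) (f x) (f y) = walk_dist (parcs G) x y"
proof -
  let ?E = "parcs G"
  have bij: "bij_betw f (pverts G) (pverts G)"
    and arc: "\<And>u v. u \<in> pverts G \<Longrightarrow> v \<in> pverts G \<Longrightarrow> (u, v) \<in> ?E \<longleftrightarrow> (f u, f v) \<in> ?E"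
    using f by (auto simp: graph_automorphism_def)
  have fwd: "(f x, f z) \<in> ?E ^^ n \<and> z \<in> pverts G" if "(x, z) \<in> ?E ^^ n" for n z
    using that
  proof (induction n arbitrary: z)
    case (Suc n)
    then obtain w where "(f x, f w) \<in> ?E ^^ n" "w \<in> pverts G" "(w, z) \<in> ?E" by auto
    then show ?case using arc E by auto
  qed (use x in auto)
  have bwd: "\<exists>w \<in> pverts G. z = f w \<and> (x, w) \<in> ?E ^^ n" if "(f x, z) \<in> ?E ^^ n" for n z
    using that
  proof (induction n arbitrary: z)
    case (Suc n)
    then obtain w where w: "(x, w) \<in> ?E ^^ n" "w \<in> pverts G" "(f w, z) \<in> ?E" by fastforce
    with E bij obtain z' where "z' \<in> pverts G" "z = f z'"
      by (metis bij_betw_imp_surj_on imageE mem_Sigma_iff subsetD)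
    with w show ?case using arc by auto
  qed (use x in auto)
  have "(f x, f y) \<in> ?E ^^ n \<longleftrightarrow> (x, y) \<in> ?E ^^ n" for n
    using fwd bwd y bij by (metis bij_betw_imp_inj_on inj_onD)
  then show ?thesis by (simp add: walk_dist_def)
qed

section \<open>The colouring with two colours\<close>

text \<open>This isolates what the colouring asks of a graph. By \<open>no_dom\<close> no neighbour
  of \<open>v\<close> can pass for \<open>v\<close>, and \<open>sep\<close> supplies the separating
  vertices on distant spheres.\<close>

lemma ex_distinguishing_2_colouring:
  fixes G :: "'a pair_pre_digraph"
  defines "V \<equiv> pverts G" and "E \<equiv> parcs G"
  assumes "simple_graph G" and "countable V" and v: "v \<in> V"
    and conn: "\<And>x y. x \<in> V \<Longrightarrow> y \<in> V \<Longrightarrow> (x, y) \<in> E\<^sup>*"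
    and nbr: "\<And>x. x \<in> V \<Longrightarrow> \<exists>y. (x, y) \<in> E"
    and no_dom: "\<And>w. (v, w) \<in> E \<Longrightarrow> \<exists>z. (w, z) \<in> E \<and> z \<noteq> v \<and> (v, z) \<notin> E"
    and sep: "\<And>x y N. x \<in> V \<Longrightarrow> y \<in> V \<Longrightarrow> x \<noteq> y \<Longrightarrow>
      \<exists>u\<in>V. N \<le> walk_dist E v u \<and> walk_dist E x u \<noteq> walk_dist E y u"
  shows "\<exists>c :: 'a \<Rightarrow> nat. (\<forall>x. c x < 2) \<and> distinguishing_colouring G c"
proof -
  interpret G: pair_bidirected_digraph G by fact
  have E: "E \<subseteq> V \<times> V" unfolding E_def V_def by (auto dest: G.in_arcsD1 G.in_arcsD2)
  have symE: "(y, x) \<in> E" if "(x, y) \<in> E" for x y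
    using that G.pair_sym_arcs unfolding E_def by (auto simp: symmetric_def dest: symD)
  have irr: "(x, x) \<notin> E" for x unfolding E_def using G.no_loops' by auto
  let ?d = "walk_dist E"
  let ?pair = "from_nat_into (V \<times> V)"
  \<comment> \<open>The bound 3 keeps a chosen vertex and all its neighbours outside the closed
    neighbourhood of \<open>v\<close>, except that a neighbour may be at distance exactly 2. The
    enumeration also runs through diagonal pairs, which impose only the distance bound.\<close>
  define good where "good n u \<longleftrightarrow> u \<in> V \<and> 3 \<le> ?d v u \<and>
    (\<forall>x y. ?pair n = (x, y) \<longrightarrow> x \<noteq> y \<longrightarrow> ?d x u \<noteq> ?d y u)" for n u
  have pick: "\<exists>u. good n u \<and> N \<le> ?d v u" for n N
  proof -
    obtain x y where xy: "?pair n = (x, y)" by fastforce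
    then have xyV: "x \<in> V" "y \<in> V" using from_nat_into[of "V \<times> V" n] v by auto
    \<comment> \<open>For a diagonal pair \<open>sep\<close> says nothing, so the distinct pair
      \<open>v\<close>, \<open>y0\<close> serves to produce some far vertex.\<close>
    obtain y0 where "(v, y0) \<in> E" using nbr v by blast
    then have y0: "y0 \<in> V" "v \<noteq> y0" using E irr by auto
    show ?thesis
      using sep[OF xyV, of "max 3 N"] sep[OF v y0, of "max 3 N"] xy
      by (cases "x = y") (auto simp: good_def)
  qed
  have "\<exists>u. \<forall>n. good n (u n) \<and> ?d v (u n) + 2 \<le> ?d v (u (Suc n))"
    by (rule dependent_nat_choice[of good "\<lambda>_ x y. ?d v x + 2 \<le> ?d v y"]) (use pick in blast)+
  then obtain u where good: "\<And>n. good n (u n)"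
    and step: "\<And>n. ?d v (u n) + 2 \<le> ?d v (u (Suc n))" by blast
  have u: "u n \<in> V" "3 \<le> ?d v (u n)" for n
    using good[of n] by (auto simp: good_def)
  have far: "?d v (u i) + 2 \<le> ?d v (u j)" if "i < j" for i j
    using that
  proof (induction j)
    case (Suc j)
    then show ?case using step[of j] by (cases "i = j") auto
  qed simp
  \<comment> \<open>Radii that differ by at least 2 leave at most one chosen vertex within any two
    consecutive spheres.\<close>
  have uinj: "i = j" if "?d v (u i) \<le> Suc (?d v (u j))" "?d v (u j) \<le> Suc (?d v (u i))" for i j
    using far[of i j] far[of j i] that by (cases i j rule: linorder_cases) auto
  define black where "black = insert v {w. (v, w) \<in> E} \<union> range u"
  define c :: "'a \<Rightarrow> nat" where "c x = (if x \<in> black then 1 else 0)" for x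
  have d1: "?d v w \<le> 1" if "(v, w) \<in> E" for w
    using that walk_dist_le[of v w 1 E] by simp
  have edge: "?d v y \<le> Suc (?d v x)" if "(x, y) \<in> E" for x y
    using walk_dist_edge_le[OF conn[OF v] that] E that by auto
  have near_black: "w = v \<or> (v, w) \<in> E" if "w \<in> black" "?d v w \<le> 2" for w
  proof (rule ccontr)
    assume "\<not> ?thesis"
    with that(1) obtain i where "w = u i" unfolding black_def by blast
    then show False using u(2)[of i] that(2) by simp
  qed
  \<comment> \<open>A neighbour of \<open>v\<close> has, by \<open>no_dom\<close>, a neighbour
    within distance 2 of \<open>v\<close> that is white. A black neighbour of \<open>u i\<close>
    would have to be some \<open>u j\<close> on the same or an adjacent sphere, hence
    \<open>u i\<close> itself, and there are no loops.\<close>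
  have centre: "w = v" if w: "w \<in> black" and wN: "\<And>z. (w, z) \<in> E \<Longrightarrow> z \<in> black" for w
  proof (rule ccontr)
    assume "w \<noteq> v"
    with w consider "(v, w) \<in> E" | i where "w = u i" unfolding black_def by blast
    then show False
    proof cases
      case 1
      with no_dom obtain z where z: "(w, z) \<in> E" "z \<noteq> v" "(v, z) \<notin> E" by blast
      have "?d v z \<le> 2" using edge[OF z(1)] d1[OF 1] by simp
      then show False using near_black wN z by blast
    next
      case 2
      then obtain z where z: "(w, z) \<in> E" using nbr u by blast
      have dz: "?d v w \<le> Suc (?d v z)" "?d v z \<le> Suc (?d v w)"
        using edge[OF z] edge[OF symE[OF z]] by auto
      have "3 \<le> ?d v w" using u 2 by simp
      then have "z \<noteq> v" "(v, z) \<notin> E" using dz d1[of z] by auto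
      then obtain j where "z = u j" using wN[OF z] unfolding black_def by blast
      then have "i = j" using uinj dz 2 by blast
      then show False using z irr 2 \<open>z = u j\<close> by blast
    qed
  qed
  have "distinguishing_colouring G c"
    unfolding distinguishing_colouring_def
  proof (intro allI impI ballI)
    fix f x
    assume f: "graph_automorphism G f"
      and col: "\<forall>i. f ` {v \<in> pverts G. c v = i} = {v \<in> pverts G. c v = i}"
      and "x \<in> pverts G"
    then have x: "x \<in> V" by (simp add: V_def)
    have fV: "f w \<in> V" if "w \<in> V" for w
      using f that unfolding graph_automorphism_def V_def by (auto dest: bij_betwE)
    have "c (f w) = c w" if "w \<in> V" for w
      using col that unfolding V_def by blast
    then have fb: "f w \<in> black \<longleftrightarrow> w \<in> black" if "w \<in> V" for w
      using that by (metis c_def zero_neq_one)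
    have fd: "?d (f a) (f b) = ?d a b" if "a \<in> V" "b \<in> V" for a b
      using walk_dist_automorphism[OF f] E that unfolding E_def V_def by blast
    \<comment> \<open>Every neighbour of \<open>f v\<close> is the image of a neighbour of
      \<open>v\<close>, so \<open>f v\<close> is black with only black neighbours.\<close>
    have fv: "f v = v"
    proof (rule centre)
      show "f v \<in> black" using fb v by (simp add: black_def)
      fix z assume z: "(f v, z) \<in> E"
      then have "z \<in> V" using E by auto
      then obtain y where y: "y \<in> V" "z = f y"
        using f unfolding graph_automorphism_def V_def by (metis bij_betw_imp_surj_on imageE)
      then have "(v, y) \<in> E" using f z v unfolding graph_automorphism_def V_def E_def by blast
      then show "z \<in> black" using fb y by (simp add: black_def)
    qed
    \<comment> \<open>As \<open>v\<close> is fixed, the image is black at an unchanged distance of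
      at least 3 from \<open>v\<close>, and only \<open>u k\<close> is such a vertex.\<close>
    have fu: "f (u k) = u k" for k
    proof -
      have uk: "u k \<in> V" "3 \<le> ?d v (u k)" using u by auto
      have d: "?d v (f (u k)) = ?d v (u k)" using fd[OF v uk(1)] fv by simp
      have "f (u k) \<in> black" using fb uk by (simp add: black_def)
      moreover have "f (u k) \<noteq> v" "(v, f (u k)) \<notin> E"
        using d uk d1[of "f (u k)"] by auto
      ultimately obtain j where "f (u k) = u j" unfolding black_def by blast
      then show ?thesis using uinj[of j k] d by simp
    qed
    show "f x = x"
    proof (rule ccontr)
      assume ne: "f x \<noteq> x"
      \<comment> \<open>The vertex \<open>u k\<close> separates \<open>x\<close> from
        \<open>f x\<close>, yet it is fixed by the distance preserving \<open>f\<close>, so it is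
        equally far from both.\<close>
      obtain k where k: "?pair k = (x, f x)"
        using from_nat_into_surj[of "V \<times> V" "(x, f x)"] \<open>countable V\<close> x fV by auto
      have "?d x (u k) \<noteq> ?d (f x) (u k)" using good[of k] k ne unfolding good_def by metis
      then show False using fd[OF x, of "u k"] fu u by metis
    qed
  qed
  then show ?thesis by (intro exI[of _ c]) (simp add: c_def)
qed

section \<open>Connectedness and diameter in terms of walk lengths\<close>

lemma ex_awalk_of_relpow:
  assumes "pair_wf_digraph G" "u \<in> pverts G" "(u, v) \<in> parcs G ^^ n"
  shows "\<exists>p. pre_digraph.awalk (with_proj G) u p v \<and> length p = n"
proof -
  interpret pair_wf_digraph G by fact
  show ?thesis
    using assms(2,3)
  proof (induction n arbitrary: u)
    case 0
    then show ?case by (auto simp: awalk_Nil_iff)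
  next
    case (Suc n)
    then obtain w where w: "(u, w) \<in> parcs G" "(w, v) \<in> parcs G ^^ n" by (meson relpow_Suc_E2)
    then obtain p where "awalk w p v" "length p = n" using Suc.IH in_arcsD2 by blast
    then have "awalk u ((u, w) # p) v \<and> length ((u, w) # p) = Suc n"
      using w by (auto simp: awalk_Cons_iff)
    then show ?case by blast
  qed
qed

text \<open>An upper bound suffices, because infinite diameter enters by contraposition.\<close>

lemma graph_distance_le:
  assumes "pair_wf_digraph G" "u \<in> pverts G" "(u, v) \<in> parcs G ^^ n"
  shows "graph_distance G u v \<le> ereal (real n)"
proof -
  interpret pair_wf_digraph G by fact
  obtain p where p: "awalk u p v" "length p = n" using ex_awalk_of_relpow[OF assms] by blast
  have "awalk_cost (\<lambda>_. 1) p = real (length p)"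
    by (induction p) auto
  then show ?thesis
    using min_cost_le_walk_cost[OF p(1), of "\<lambda>_. 1"] p(2) by (simp add: graph_distance_def)
qed

text \<open>Connectedness of a digraph refers to its symmetric closure. The arcs here are symmetric
  already, so it yields directed walks.\<close>

lemma connected_simple_graph_rtrancl:
  assumes "simple_graph G" "Digraph_Component.connected (with_proj G)"
    "u \<in> pverts G" "v \<in> pverts G"
  shows "(u, v) \<in> (parcs G)\<^sup>*"
proof -
  interpret pair_bidirected_digraph G by fact
  have "strongly_connected (with_proj G)"
    using symmetric_connected_imp_strongly_connected pair_sym_arcs assms(2) by blast
  then have "u \<rightarrow>\<^sup>*\<^bsub>with_proj G\<^esub> v" using assms(3,4) by (simp add: strongly_connected_def)
  then have "(u, v) \<in> (arcs_ends (with_proj G))\<^sup>*" by (rule reachable_rtranclI)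
  then show ?thesis by simp
qed

text \<open>If every vertex were close to \<open>w\<close>, walks through \<open>w\<close> would
  bound all distances by \<open>2 * N\<close>.\<close>

lemma infinite_diameter_imp_far_vertex:
  assumes "simple_graph G" "Digraph_Component.connected (with_proj G)"
    "graph_diameter G = \<infinity>" "w \<in> pverts G"
  shows "\<exists>r\<in>pverts G. N \<le> walk_dist (parcs G) w r"
proof (rule ccontr)
  interpret pair_bidirected_digraph G by fact
  let ?d = "walk_dist (parcs G)"
  assume "\<not> ?thesis"
  then have small: "?d w r \<le> N" if "r \<in> pverts G" for r using that by force
  have "sym (parcs G)" using pair_sym_arcs by (simp add: symmetric_def)
  have "graph_distance G u v \<le> ereal (real (2 * N))" if uv: "u \<in> pverts G" "v \<in> pverts G" for u v
  proof -
    have rt: "(x, y) \<in> parcs G ^^ ?d x y" if "x \<in> pverts G" "y \<in> pverts G" for x y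
      using that assms connected_simple_graph_rtrancl relpow_walk_dist by fast
    have "(u, v) \<in> parcs G ^^ (?d u w + ?d w v)"
      using rt uv assms(4) by (auto simp: relpow_add)
    then have "graph_distance G u v \<le> ereal (real (?d u w + ?d w v))"
      by (rule graph_distance_le[OF pair_wf_digraph_axioms uv(1)])
    also have "\<dots> \<le> ereal (real (2 * N))"
      using small[OF uv(1)] small[OF uv(2)] walk_dist_sym[OF \<open>sym (parcs G)\<close>, of u w] by simp
    finally show ?thesis .
  qed
  then have "graph_diameter G \<le> ereal (real (2 * N))"
    unfolding graph_diameter_def by (intro SUP_least)
  then show False using assms(3) by simp
qed

lemma connected_simple_graph_ex_neighbour:
  assumes "simple_graph G" "Digraph_Component.connected (with_proj G)"
    "infinite (pverts G)" "u \<in> pverts G"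
  shows "\<exists>v. (u, v) \<in> parcs G"
proof -
  obtain w where "w \<in> pverts G" "w \<noteq> u"
    using assms(3) by (metis finite.simps finite_insert insertI1 insert_iff finite_subset subsetI)
  then show ?thesis
    using connected_simple_graph_rtrancl[OF assms(1,2,4)] by (metis converse_rtranclE)
qed

section \<open>The lower bound\<close>

text \<open>With fewer than two colours every colour class is empty or the whole vertex set, and any
  automorphism preserves both.\<close>

lemma distinguishing_number_ge_2:
  assumes f: "graph_automorphism G f" and x: "x \<in> pverts G" "f x \<noteq> x"
  shows "2 \<le> distinguishing_number G"
  unfolding distinguishing_number_def
proof (rule Inf_greatest)
  fix n assume "n \<in> {enat k |k. \<exists>c :: 'a \<Rightarrow> nat. (\<forall>v\<in>pverts G. c v < k) \<and> distinguishing_colouring G c}"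
  then obtain k and c :: "'a \<Rightarrow> nat" where n: "n = enat k"
    and c: "\<forall>v\<in>pverts G. c v < k" "distinguishing_colouring G c" by blast
  have "\<not> k < 2"
  proof
    assume "k < 2"
    then have "c v = 0" if "v \<in> pverts G" for v using c(1) that by force
    then have "{v \<in> pverts G. c v = i} = (if i = 0 then pverts G else {})" for i by auto
    moreover have "f ` pverts G = pverts G"
      using f by (simp add: graph_automorphism_def bij_betw_def)
    ultimately have "\<forall>i. f ` {v \<in> pverts G. c v = i} = {v \<in> pverts G. c v = i}" by simp
    then show False using c(2) f x unfolding distinguishing_colouring_def by blast
  qed
  then show "2 \<le> n" using n by (simp add: numeral_eq_enat)
qed

section \<open>Products of graphs of infinite diameter\<close>

text \<open>Equality is conditional because the product can be rigid, and then one colour is enough.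
  A ray times a different rigid tree is an example.\<close>

theorem theorem4:
  fixes \<Lambda> :: "'a pair_pre_digraph" and \<Theta> :: "'b pair_pre_digraph"
  assumes "simple_graph \<Lambda>" and "simple_graph \<Theta>"
    and "Digraph_Component.connected (with_proj \<Lambda>)"
    and "Digraph_Component.connected (with_proj \<Theta>)"
    and "countable (pverts \<Lambda>)" and "infinite (pverts \<Lambda>)"
    and "countable (pverts \<Theta>)" and "infinite (pverts \<Theta>)"
    and "graph_diameter \<Lambda> = \<infinity>" and "graph_diameter \<Theta> = \<infinity>"
  shows "distinguishing_number (\<Lambda> \<box> \<Theta>) \<le> 2 \<and>
    ((\<exists>f. graph_automorphism (\<Lambda> \<box> \<Theta>) f \<and> (\<exists>v\<in>pverts (\<Lambda> \<box> \<Theta>). f v \<noteq> v)) \<longrightarrow>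
      distinguishing_number (\<Lambda> \<box> \<Theta>) = 2)"
proof -
  interpret L: pair_bidirected_digraph \<Lambda> by fact
  interpret T: pair_bidirected_digraph \<Theta> by fact
  let ?A = "pverts \<Lambda>" and ?B = "pverts \<Theta>" and ?R = "parcs \<Lambda>" and ?S = "parcs \<Theta>"
    and ?P = "parcs (\<Lambda> \<box> \<Theta>)"
  have R: "?R \<subseteq> ?A \<times> ?A" by (auto dest: L.in_arcsD1 L.in_arcsD2)
  have S: "?S \<subseteq> ?B \<times> ?B" by (auto dest: T.in_arcsD1 T.in_arcsD2)
  have P: "?P = {((u, x), (v, y)).
      (u = v \<and> u \<in> ?A \<and> (x, y) \<in> ?S) \<or> (x = y \<and> x \<in> ?B \<and> (u, v) \<in> ?R)}"
    and V: "pverts (\<Lambda> \<box> \<Theta>) = ?A \<times> ?B"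
    by (simp_all add: cartesian_product_def)
  note connL = connected_simple_graph_rtrancl[OF assms(1,3)]
    and connT = connected_simple_graph_rtrancl[OF assms(2,4)]
  note nbrL = connected_simple_graph_ex_neighbour[OF assms(1,3,6)]
    and nbrT = connected_simple_graph_ex_neighbour[OF assms(2,4,8)]
  have dist: "walk_dist ?P (a, p) (b, q) = walk_dist ?R a b + walk_dist ?S p q"
    if "a \<in> ?A" "b \<in> ?A" "p \<in> ?B" "q \<in> ?B" for a b p q
    using walk_dist_product[OF R S P] connL connT that by blast
  have posL: "0 < walk_dist ?R a b" if "a \<in> ?A" "b \<in> ?A" "a \<noteq> b" for a b
    using walk_dist_eq_0_iff[OF connL] that by blast
  have posT: "0 < walk_dist ?S a b" if "a \<in> ?B" "b \<in> ?B" "a \<noteq> b" for a b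
    using walk_dist_eq_0_iff[OF connT] that by blast
  have symL: "walk_dist ?R a b = walk_dist ?R b a" for a b
    using L.pair_sym_arcs by (intro walk_dist_sym) (simp add: symmetric_def)
  have symT: "walk_dist ?S a b = walk_dist ?S b a" for a b
    using T.pair_sym_arcs by (intro walk_dist_sym) (simp add: symmetric_def)
  obtain o1 o2 where o1: "o1 \<in> ?A" and o2: "o2 \<in> ?B"
    using assms(6,8) by (metis all_not_in_conv finite.emptyI)
  have "\<exists>c :: 'a \<times> 'b \<Rightarrow> nat. (\<forall>x. c x < 2) \<and> distinguishing_colouring (\<Lambda> \<box> \<Theta>) c"
  proof (rule ex_distinguishing_2_colouring[where v = "(o1, o2)"])
    show "simple_graph (\<Lambda> \<box> \<Theta>)" using assms(1,2) by (rule simple_graph_cartesian_product)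
    show "countable (pverts (\<Lambda> \<box> \<Theta>))" using assms(5,7) by (simp add: V)
    show "(o1, o2) \<in> pverts (\<Lambda> \<box> \<Theta>)" using o1 o2 by (simp add: V)
  next
    fix x y assume "x \<in> pverts (\<Lambda> \<box> \<Theta>)" "y \<in> pverts (\<Lambda> \<box> \<Theta>)"
    then show "(x, y) \<in> ?P\<^sup>*"
      using rtrancl_product[OF R S P] connL connT unfolding V by (cases x, cases y) auto
  next
    fix x assume "x \<in> pverts (\<Lambda> \<box> \<Theta>)"
    then show "\<exists>y. (x, y) \<in> ?P" using nbrL[of "fst x"] unfolding V P by (cases x) auto
  next
    fix w assume w: "((o1, o2), w) \<in> ?P"
    obtain w1 w2 where w12: "w = (w1, w2)" by fastforce
    \<comment> \<open>From \<open>w\<close>, one move in the coordinate it shares with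
      \<open>(o1, o2)\<close> reaches a vertex that differs from \<open>(o1, o2)\<close> in both
      coordinates and so is neither equal nor adjacent to it.\<close>
    obtain n1 n2 where n: "(o1, n1) \<in> ?R" "(o2, n2) \<in> ?S" using nbrL nbrT o1 o2 by blast
    then have ne: "n1 \<noteq> o1" "n2 \<noteq> o2" using L.no_loops' T.no_loops' by auto
    from w w12 consider "w1 = o1" "(o2, w2) \<in> ?S" | "w2 = o2" "(o1, w1) \<in> ?R"
      unfolding P by auto
    then show "\<exists>z. (w, z) \<in> ?P \<and> z \<noteq> (o1, o2) \<and> ((o1, o2), z) \<notin> ?P"
    proof cases
      case 1
      then have "w2 \<noteq> o2" "w2 \<in> ?B" using T.no_loops' S by auto
      then show ?thesis using 1 n ne w12 by (intro exI[of _ "(n1, w2)"]) (auto simp: P)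
    next
      case 2
      then have "w1 \<noteq> o1" "w1 \<in> ?A" using L.no_loops' R by auto
      then show ?thesis using 2 n ne w12 by (intro exI[of _ "(w1, n2)"]) (auto simp: P)
    qed
  next
    fix x y N assume xy: "x \<in> pverts (\<Lambda> \<box> \<Theta>)" "y \<in> pverts (\<Lambda> \<box> \<Theta>)" "x \<noteq> y"
    obtain a p b q where x: "x = (a, p)" and y: "y = (b, q)" by fastforce
    have ab: "a \<in> ?A" "p \<in> ?B" "b \<in> ?A" "q \<in> ?B" using xy x y V by auto
    let ?sep = "\<lambda>u. u \<in> pverts (\<Lambda> \<box> \<Theta>) \<and> N \<le> walk_dist ?P (o1, o2) u \<and>
      walk_dist ?P x u \<noteq> walk_dist ?P y u"
    have "\<exists>u. ?sep u"
    proof (cases "a = b")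
      case False
      obtain r where r: "r \<in> ?B" "N \<le> walk_dist ?S o2 r"
        using infinite_diameter_imp_far_vertex[OF assms(2,4,10) o2] by blast
      \<comment> \<open>Let D be the distance of \<open>a\<close> and \<open>b\<close>. If both
        failed, the distances of \<open>p\<close> and \<open>q\<close> to \<open>r\<close> would
        differ by D in either direction, forcing D = 0. The coordinate \<open>r\<close> alone puts
        both candidates far from \<open>(o1, o2)\<close>.\<close>
      have "?sep (a, r) \<or> ?sep (b, r)"
        using posL[OF ab(1,3) False] symL[of a b] r ab o1 o2 by (auto simp: x y V dist)
      then show ?thesis by blast
    next
      case True
      then have False: "p \<noteq> q" using xy x y by auto
      obtain r where r: "r \<in> ?A" "N \<le> walk_dist ?R o1 r"
        using infinite_diameter_imp_far_vertex[OF assms(1,3,9) o1] by blast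
      \<comment> \<open>Here the factors exchange roles, so far vertices come from the diameter of
        \<open>\<Lambda>\<close>.\<close>
      have "?sep (r, p) \<or> ?sep (r, q)"
        using posT[OF ab(2,4) False] symT[of p q] r ab o1 o2 by (auto simp: x y V dist)
      then show ?thesis by blast
    qed
    then show "\<exists>u\<in>pverts (\<Lambda> \<box> \<Theta>). N \<le> walk_dist ?P (o1, o2) u \<and>
        walk_dist ?P x u \<noteq> walk_dist ?P y u" by blast
  qed
  then have "distinguishing_number (\<Lambda> \<box> \<Theta>) \<le> enat 2"
    unfolding distinguishing_number_def by (intro Inf_lower) blast
  then have "distinguishing_number (\<Lambda> \<box> \<Theta>) \<le> 2" by (simp add: numeral_eq_enat)
  moreover have "2 \<le> distinguishing_number (\<Lambda> \<box> \<Theta>)"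
    if "graph_automorphism (\<Lambda> \<box> \<Theta>) f" "x \<in> pverts (\<Lambda> \<box> \<Theta>)" "f x \<noteq> x" for f x
    using that by (rule distinguishing_number_ge_2)
  ultimately show ?thesis by (meson order_antisym)
qed

end
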